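(* Let $\mathcal{G}$ be a finite groupoid, $K$ a commutative ring, $R$ an associative unital $K$-algebra, and $\beta=(\{E_g\}_{g\in\mathcal{G}},\{\beta_g\}_{g\in\mathcal{G}})$ a unital action of $\mathcal{G}$ on $R$ with $R=\bigoplus_{e\in\mathcal{G}_0}E_e$. Suppose that $R$ is a $\beta$-Galois extension of $R^{\beta}$ and that $R^{\beta}$ is separable over $C(R)^{\beta}$. Let $\mathcal{A}=\{\overline{\mathcal{H}} \mid \mathcal{H} \text{ a wide subgroupoid of } \mathcal{G}\}$. Then the maps on $\mathcal{A}$ given, for $\mathcal{H}$ a wide subgroupoid of $\mathcal{G}$, by $$\overline{\sigma}:\overline{\mathcal{H}}\mapsto \theta(\mathcal{H})C(R)\qquad\text{and}\qquad \overline{\gamma}:\overline{\mathcal{H}}\mapsto V_R(\theta(\mathcal{H}))$$ are both injective.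
   Context: A groupoid $\mathcal{G}$ is a small category in which every morphism is invertible; it is identified with its set of morphisms, and is finite if this set is finite. $d(g)$, $r(g)$ are the domain and range of $g$, $\mathcal{G}_0$ is the set of objects, identified with the identity morphisms; $gh$ is defined iff $d(g)=r(h)$. A subgroupoid is a non-empty subset closed under (defined) products and inverses; a subgroupoid $\mathcal{H}$ is wide if $\mathcal{H}_0=\mathcal{G}_0$. An action $\beta=(\{E_g\},\{\beta_g\})$ of $\mathcal{G}$ on $R$: for each $g$, $E_g=E_{r(g)}$ is an ideal of $R$ and $\beta_g:E_{g^{-1}}\to E_g$ is a $K$-algebra isomorphism, with $\beta_e=\mathrm{Id}_{E_e}$ for $e\in\mathcal{G}_0$ and $\beta_g(\beta_h(r))=\beta_{gh}(r)$ whenever $d(g)=r(h)$ and $r\in E_{h^{-1}}=E_{(gh)^{-1}}$. It is unital if each $E_g$ has an identity element, denoted $1_g$. Invariants: $R^{\beta}=\{r\in R\mid \beta_g(r1_{g^{-1}})=r1_g \text{ for all } g\in\mathcal{G}\}$. $C(R)$ is the center of $R$ and $C(R)^{\beta}=C(R)\cap R^{\beta}$. For a wide subgroupoid $\mathcal{H}$, $\beta_{\mathcal{H}}=\{\beta_h\mid h\in\mathcal{H}\}$ is an action of $\mathcal{H}$ on $R$ and $R^{\beta_{\mathcal{H}}}=\{r\in R\mid \beta_h(r1_{h^{-1}})=r1_h \text{ for all } h\in\mathcal{H}\}$. $R$ is a $\beta$-Galois extension of $R^{\beta}$ if there are $x_i,y_i\in R$, $1\le i\le m$, with $\sum_i x_i\beta_g(y_i1_{g^{-1}})=\sum_{e\in\mathcal{G}_0}\delta_{e,g}1_e$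 for all $g\in\mathcal{G}$. A ring $A$ is separable over a subring $S$ if there is $z=\sum_i a_i\otimes b_i\in A\otimes_S A$ with $\sum_i a_ib_i=1_A$ and $az=za$ for all $a\in A$. For a subring $S$ of $R$, $V_R(S)=\{r\in R\mid rs=sr \text{ for all } s\in S\}$, and $SC(R)$ is the set of finite sums of products $sc$ with $s\in S$, $c\in C(R)$. For $g\in\mathcal{G}$, $J_g=\{r\in E_g\mid r\beta_g(x1_{g^{-1}})=xr \text{ for all } x\in R\}$. For a subgroupoid $\mathcal{H}$, $S_{\mathcal{H}}=\{g\in\mathcal{H}\mid J_g\neq\{0\}\}$ and $\overline{\mathcal{H}}=\{\mathcal{L}\mid \mathcal{L} \text{ is a subgroupoid of } \mathcal{G} \text{ and } S_{\mathcal{L}}=S_{\mathcal{H}}\}$. The Galois map is $\theta:\mathcal{H}\mapsto R^{\beta_{\mathcal{H}}}$, defined on wide subgroupoids $\mathcal{H}$ of $\mathcal{G}$. The maps $\overline{\sigma}$, $\overline{\gamma}$ are well defined on $\mathcal{A}$, i.e. their values depend only on $\overline{\mathcal{H}}$. *)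

theory Defs
  imports "HOL-Algebra.Algebra"
begin

section \<open>Groupoids\<close>

text \<open>
  A groupoid is given by its set of arrows; objects are identified with identity arrows.
  The product \<open>prd G g h\<close> is meaningful only if \<open>src G g = tgt G h\<close>.
\<close>

record 'g groupoid_struct =
  Arr :: "'g set"
  src :: "'g \<Rightarrow> 'g"
  tgt :: "'g \<Rightarrow> 'g"
  prd :: "'g \<Rightarrow> 'g \<Rightarrow> 'g"
  ginv :: "'g \<Rightarrow> 'g"

definition objects :: "('g, 'm) groupoid_struct_scheme \<Rightarrow> 'g set \<Rightarrow> 'g set" where
  "objects G H = {e \<in> H. src G e = e}"

locale groupoid =
  fixes G :: "('g, 'm) groupoid_struct_scheme"
  assumes src_closed: "g \<in> Arr G \<Longrightarrow> src G g \<in> Arr G"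
    and tgt_closed: "g \<in> Arr G \<Longrightarrow> tgt G g \<in> Arr G"
    and src_src: "g \<in> Arr G \<Longrightarrow> src G (src G g) = src G g"
    and tgt_src: "g \<in> Arr G \<Longrightarrow> tgt G (src G g) = src G g"
    and src_tgt: "g \<in> Arr G \<Longrightarrow> src G (tgt G g) = tgt G g"
    and tgt_tgt: "g \<in> Arr G \<Longrightarrow> tgt G (tgt G g) = tgt G g"
    and prd_closed: "\<lbrakk>g \<in> Arr G; h \<in> Arr G; src G g = tgt G h\<rbrakk> \<Longrightarrow> prd G g h \<in> Arr G"
    and src_prd: "\<lbrakk>g \<in> Arr G; h \<in> Arr G; src G g = tgt G h\<rbrakk> \<Longrightarrow> src G (prd G g h) = src G h"
    and tgt_prd: "\<lbrakk>g \<in> Arr G; h \<in> Arr G; src G g = tgt G h\<rbrakk> \<Longrightarrow> tgt G (prd G g h) = tgt G g"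
    and prd_assoc: "\<lbrakk>g \<in> Arr G; h \<in> Arr G; k \<in> Arr G; src G g = tgt G h; src G h = tgt G k\<rbrakk>
      \<Longrightarrow> prd G (prd G g h) k = prd G g (prd G h k)"
    and prd_src: "g \<in> Arr G \<Longrightarrow> prd G g (src G g) = g"
    and tgt_prd_id: "g \<in> Arr G \<Longrightarrow> prd G (tgt G g) g = g"
    and ginv_closed: "g \<in> Arr G \<Longrightarrow> ginv G g \<in> Arr G"
    and src_ginv: "g \<in> Arr G \<Longrightarrow> src G (ginv G g) = tgt G g"
    and tgt_ginv: "g \<in> Arr G \<Longrightarrow> tgt G (ginv G g) = src G g"
    and prd_ginv: "g \<in> Arr G \<Longrightarrow> prd G g (ginv G g) = tgt G g"
    and ginv_prd: "g \<in> Arr G \<Longrightarrow> prd G (ginv G g) g = src G g"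

definition subgroupoid :: "('g, 'm) groupoid_struct_scheme \<Rightarrow> 'g set \<Rightarrow> bool" where
  "subgroupoid G H \<longleftrightarrow> H \<subseteq> Arr G \<and> H \<noteq> {} \<and>
     (\<forall>g\<in>H. \<forall>h\<in>H. src G g = tgt G h \<longrightarrow> prd G g h \<in> H) \<and> (\<forall>g\<in>H. ginv G g \<in> H)"

definition wide_subgroupoid :: "('g, 'm) groupoid_struct_scheme \<Rightarrow> 'g set \<Rightarrow> bool" where
  "wide_subgroupoid G H \<longleftrightarrow> subgroupoid G H \<and> objects G H = objects G (Arr G)"


section \<open>Associative algebras and unital groupoid actions\<close>

text \<open>The library locale \<^locale>\<open>algebra\<close> covers only commutative algebras.\<close>

locale assoc_algebra = module K R + ring R
  for K :: "('k, 'n) ring_scheme" and R :: "('k, 'r, 'p) module_scheme" (structure) +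
  assumes smult_mult_left: "\<lbrakk>a \<in> carrier K; x \<in> carrier R; y \<in> carrier R\<rbrakk>
      \<Longrightarrow> (a \<odot> x) \<otimes> y = a \<odot> (x \<otimes> y)"
    and smult_mult_right: "\<lbrakk>a \<in> carrier K; x \<in> carrier R; y \<in> carrier R\<rbrakk>
      \<Longrightarrow> x \<otimes> (a \<odot> y) = a \<odot> (x \<otimes> y)"

definition is_identity_of :: "('r, 'm) ring_scheme \<Rightarrow> 'r set \<Rightarrow> 'r \<Rightarrow> bool" where
  "is_identity_of R I u \<longleftrightarrow> u \<in> I \<and> (\<forall>x\<in>I. u \<otimes>\<^bsub>R\<^esub> x = x \<and> x \<otimes>\<^bsub>R\<^esub> u = x)"

text \<open>The element written \<open>1\<^sub>g\<close> in the literature is \<open>identity_of R (E g)\<close>.\<close>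

definition identity_of :: "('r, 'm) ring_scheme \<Rightarrow> 'r set \<Rightarrow> 'r" where
  "identity_of R I = (THE u. is_identity_of R I u)"

locale groupoid_action = groupoid G + assoc_algebra K R
  for G :: "('g, 'm) groupoid_struct_scheme"
    and K :: "('k, 'n) ring_scheme"
    and R :: "('k, 'r, 'p) module_scheme" (structure) +
  fixes E :: "'g \<Rightarrow> 'r set" and \<beta> :: "'g \<Rightarrow> 'r \<Rightarrow> 'r"
  assumes E_tgt: "g \<in> Arr G \<Longrightarrow> E g = E (tgt G g)"
    and E_ideal: "g \<in> Arr G \<Longrightarrow> ideal (E g) R"
    and beta_bij: "g \<in> Arr G \<Longrightarrow> bij_betw (\<beta> g) (E (ginv G g)) (E g)"
    and beta_add: "\<lbrakk>g \<in> Arr G; x \<in> E (ginv G g); y \<in> E (ginv G g)\<rbrakk>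
      \<Longrightarrow> \<beta> g (x \<oplus> y) = \<beta> g x \<oplus> \<beta> g y"
    and beta_mult: "\<lbrakk>g \<in> Arr G; x \<in> E (ginv G g); y \<in> E (ginv G g)\<rbrakk>
      \<Longrightarrow> \<beta> g (x \<otimes> y) = \<beta> g x \<otimes> \<beta> g y"
    and beta_smult: "\<lbrakk>g \<in> Arr G; a \<in> carrier K; x \<in> E (ginv G g)\<rbrakk>
      \<Longrightarrow> \<beta> g (a \<odot> x) = a \<odot> \<beta> g x"
    and beta_object: "\<lbrakk>e \<in> objects G (Arr G); x \<in> E e\<rbrakk> \<Longrightarrow> \<beta> e x = x"
    and beta_comp: "\<lbrakk>g \<in> Arr G; h \<in> Arr G; src G g = tgt G h; x \<in> E (ginv G h)\<rbrakk>
      \<Longrightarrow> \<beta> g (\<beta> h x) = \<beta> (prd G g h) x"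

locale unital_groupoid_action = groupoid_action +
  assumes E_unital: "g \<in> Arr G \<Longrightarrow> \<exists>u. is_identity_of R (E g) u"

text \<open>The ring is the internal direct sum of the additive subgroups \<open>E e\<close>, \<open>e \<in> I\<close>, for finite \<open>I\<close>.\<close>

definition is_direct_sum :: "('r, 'm) ring_scheme \<Rightarrow> 'e set \<Rightarrow> ('e \<Rightarrow> 'r set) \<Rightarrow> bool" where
  "is_direct_sum R I E \<longleftrightarrow> (\<forall>e\<in>I. E e \<subseteq> carrier R) \<and>
     (\<forall>r\<in>carrier R. \<exists>!f. f \<in> (\<Pi>\<^sub>E e\<in>I. E e) \<and> r = (\<Oplus>\<^bsub>R\<^esub>e\<in>I. f e))"

text \<open>
  \<open>invariant_ring R G E \<beta> H\<close> is the ring of invariants of the action restricted to \<open>H\<close>, so the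
  invariants of \<open>\<beta>\<close> itself are \<open>invariant_ring R G E \<beta> (Arr G)\<close>, and on wide subgroupoids
  \<open>H \<mapsto> invariant_ring R G E \<beta> H\<close> is the Galois map.
\<close>

definition invariant_ring :: "('r, 'p) ring_scheme \<Rightarrow> ('g, 'm) groupoid_struct_scheme
    \<Rightarrow> ('g \<Rightarrow> 'r set) \<Rightarrow> ('g \<Rightarrow> 'r \<Rightarrow> 'r) \<Rightarrow> 'g set \<Rightarrow> 'r set" where
  "invariant_ring R G E \<beta> H = {r \<in> carrier R. \<forall>h\<in>H.
     \<beta> h (r \<otimes>\<^bsub>R\<^esub> identity_of R (E (ginv G h))) = r \<otimes>\<^bsub>R\<^esub> identity_of R (E h)}"

definition galois_extension :: "('r, 'p) ring_scheme \<Rightarrow> ('g, 'm) groupoid_struct_scheme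
    \<Rightarrow> ('g \<Rightarrow> 'r set) \<Rightarrow> ('g \<Rightarrow> 'r \<Rightarrow> 'r) \<Rightarrow> bool" where
  "galois_extension R G E \<beta> \<longleftrightarrow>
     (\<exists>(m::nat) x y. x \<in> {1..m} \<rightarrow> carrier R \<and> y \<in> {1..m} \<rightarrow> carrier R \<and>
       (\<forall>g\<in>Arr G.
         (\<Oplus>\<^bsub>R\<^esub>i\<in>{1..m}. x i \<otimes>\<^bsub>R\<^esub> \<beta> g (y i \<otimes>\<^bsub>R\<^esub> identity_of R (E (ginv G g)))) =
         (\<Oplus>\<^bsub>R\<^esub>e\<in>objects G (Arr G). if e = g then identity_of R (E e) else \<zero>\<^bsub>R\<^esub>)))"


section \<open>Centralizers and separability\<close>

definition centralizer :: "('r, 'p) ring_scheme \<Rightarrow> 'r set \<Rightarrow> 'r set" where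
  "centralizer R S = {r \<in> carrier R. \<forall>s\<in>S. r \<otimes>\<^bsub>R\<^esub> s = s \<otimes>\<^bsub>R\<^esub> r}"

definition center :: "('r, 'p) ring_scheme \<Rightarrow> 'r set" where
  "center R = centralizer R (carrier R)"

text \<open>The set of finite sums of products \<open>s c\<close> with \<open>s \<in> S\<close> and \<open>c\<close> central.\<close>

definition mult_center :: "('r, 'p) ring_scheme \<Rightarrow> 'r set \<Rightarrow> 'r set" where
  "mult_center R S = {(\<Oplus>\<^bsub>R\<^esub>i\<in>{1..n}. s i \<otimes>\<^bsub>R\<^esub> c i) | (n::nat) s c.
     s \<in> {1..n} \<rightarrow> S \<and> c \<in> {1..n} \<rightarrow> center R}"

text \<open>
  The tensor product of \<open>A\<close> with itself over a (not necessarily central) subring \<open>S\<close>, as the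
  quotient of the free abelian group on pairs by the biadditivity and \<open>S\<close>-balancing relations.
  The library writes abelian groups such as this one multiplicatively.
\<close>

definition tensor_relators :: "('r, 'p) ring_scheme \<Rightarrow> 'r set \<Rightarrow> ('r \<times> 'r \<Rightarrow>\<^sub>0 int) set" where
  "tensor_relators A S =
     {frag_of (a \<oplus>\<^bsub>A\<^esub> a', b) - frag_of (a, b) - frag_of (a', b) | a a' b.
        a \<in> carrier A \<and> a' \<in> carrier A \<and> b \<in> carrier A} \<union>
     {frag_of (a, b \<oplus>\<^bsub>A\<^esub> b') - frag_of (a, b) - frag_of (a, b') | a b b'.
        a \<in> carrier A \<and> b \<in> carrier A \<and> b' \<in> carrier A} \<union>
     {frag_of (a \<otimes>\<^bsub>A\<^esub> s, b) - frag_of (a, s \<otimes>\<^bsub>A\<^esub> b) | a s b.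
        a \<in> carrier A \<and> s \<in> S \<and> b \<in> carrier A}"

definition tensor_null :: "('r, 'p) ring_scheme \<Rightarrow> 'r set \<Rightarrow> ('r \<times> 'r \<Rightarrow>\<^sub>0 int) set" where
  "tensor_null A S =
     generate (free_Abelian_group (carrier A \<times> carrier A)) (tensor_relators A S)"

definition tensor_square :: "('r, 'p) ring_scheme \<Rightarrow> 'r set \<Rightarrow> ('r \<times> 'r \<Rightarrow>\<^sub>0 int) set monoid" where
  "tensor_square A S = free_Abelian_group (carrier A \<times> carrier A) Mod tensor_null A S"

definition pure_tensor ::
    "('r, 'p) ring_scheme \<Rightarrow> 'r set \<Rightarrow> 'r \<Rightarrow> 'r \<Rightarrow> ('r \<times> 'r \<Rightarrow>\<^sub>0 int) set" where
  "pure_tensor A S a b =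
     tensor_null A S #>\<^bsub>free_Abelian_group (carrier A \<times> carrier A)\<^esub> frag_of (a, b)"

text \<open>
  With \<open>z = (\<Sum>i. a i \<otimes> b i)\<close>, the last conjunct is \<open>x z = z x\<close> for the bimodule structure
  \<open>x (a \<otimes> b) = (x a) \<otimes> b\<close> and \<open>(a \<otimes> b) x = a \<otimes> (b x)\<close>.
\<close>

definition separable_over :: "('r, 'p) ring_scheme \<Rightarrow> 'r set \<Rightarrow> bool" where
  "separable_over A S \<longleftrightarrow>
     (\<exists>(n::nat) a b. a \<in> {1..n} \<rightarrow> carrier A \<and> b \<in> {1..n} \<rightarrow> carrier A \<and>
       (\<Oplus>\<^bsub>A\<^esub>i\<in>{1..n}. a i \<otimes>\<^bsub>A\<^esub> b i) = \<one>\<^bsub>A\<^esub> \<and>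
       (\<forall>x\<in>carrier A.
         (\<Otimes>\<^bsub>tensor_square A S\<^esub>i\<in>{1..n}. pure_tensor A S (x \<otimes>\<^bsub>A\<^esub> a i) (b i)) =
         (\<Otimes>\<^bsub>tensor_square A S\<^esub>i\<in>{1..n}. pure_tensor A S (a i) (b i \<otimes>\<^bsub>A\<^esub> x))))"


section \<open>Classes of subgroupoids and the induced maps\<close>

definition J_set :: "('r, 'p) ring_scheme \<Rightarrow> ('g, 'm) groupoid_struct_scheme
    \<Rightarrow> ('g \<Rightarrow> 'r set) \<Rightarrow> ('g \<Rightarrow> 'r \<Rightarrow> 'r) \<Rightarrow> 'g \<Rightarrow> 'r set" where
  "J_set R G E \<beta> g = {r \<in> E g. \<forall>x\<in>carrier R.
     r \<otimes>\<^bsub>R\<^esub> \<beta> g (x \<otimes>\<^bsub>R\<^esub> identity_of R (E (ginv G g))) = x \<otimes>\<^bsub>R\<^esub> r}"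

definition S_set :: "('r, 'p) ring_scheme \<Rightarrow> ('g, 'm) groupoid_struct_scheme
    \<Rightarrow> ('g \<Rightarrow> 'r set) \<Rightarrow> ('g \<Rightarrow> 'r \<Rightarrow> 'r) \<Rightarrow> 'g set \<Rightarrow> 'g set" where
  "S_set R G E \<beta> H = {g \<in> H. J_set R G E \<beta> g \<noteq> {\<zero>\<^bsub>R\<^esub>}}"

definition S_class :: "('r, 'p) ring_scheme \<Rightarrow> ('g, 'm) groupoid_struct_scheme
    \<Rightarrow> ('g \<Rightarrow> 'r set) \<Rightarrow> ('g \<Rightarrow> 'r \<Rightarrow> 'r) \<Rightarrow> 'g set \<Rightarrow> 'g set set" where
  "S_class R G E \<beta> H = {L. subgroupoid G L \<and> S_set R G E \<beta> L = S_set R G E \<beta> H}"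

definition wide_classes :: "('r, 'p) ring_scheme \<Rightarrow> ('g, 'm) groupoid_struct_scheme
    \<Rightarrow> ('g \<Rightarrow> 'r set) \<Rightarrow> ('g \<Rightarrow> 'r \<Rightarrow> 'r) \<Rightarrow> 'g set set set" where
  "wide_classes R G E \<beta> = {S_class R G E \<beta> H | H. wide_subgroupoid G H}"

text \<open>
  The maps on \<open>wide_classes R G E \<beta>\<close> are given by their values on representatives. A choice
  \<open>\<rho>\<close> of a wide representative of every class is kept as a parameter: the values do not depend
  on it, but this is a theorem about the action and not part of the definition. A class may also
  contain subgroupoids that are not wide; these are not admitted as representatives.
\<close>

definition wide_representatives :: "('r, 'p) ring_scheme \<Rightarrow> ('g, 'm) groupoid_struct_scheme
    \<Rightarrow> ('g \<Rightarrow> 'r set) \<Rightarrow> ('g \<Rightarrow> 'r \<Rightarrow> 'r) \<Rightarrow> ('g set set \<Rightarrow> 'g set) \<Rightarrow> bool" where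
  "wide_representatives R G E \<beta> \<rho> \<longleftrightarrow>
     (\<forall>Q\<in>wide_classes R G E \<beta>. wide_subgroupoid G (\<rho> Q) \<and> S_class R G E \<beta> (\<rho> Q) = Q)"

definition sigma_bar :: "('r, 'p) ring_scheme \<Rightarrow> ('g, 'm) groupoid_struct_scheme
    \<Rightarrow> ('g \<Rightarrow> 'r set) \<Rightarrow> ('g \<Rightarrow> 'r \<Rightarrow> 'r) \<Rightarrow> ('g set set \<Rightarrow> 'g set) \<Rightarrow> 'g set set \<Rightarrow> 'r set" where
  "sigma_bar R G E \<beta> \<rho> Q = mult_center R (invariant_ring R G E \<beta> (\<rho> Q))"

definition gamma_bar :: "('r, 'p) ring_scheme \<Rightarrow> ('g, 'm) groupoid_struct_scheme
    \<Rightarrow> ('g \<Rightarrow> 'r set) \<Rightarrow> ('g \<Rightarrow> 'r \<Rightarrow> 'r) \<Rightarrow> ('g set set \<Rightarrow> 'g set) \<Rightarrow> 'g set set \<Rightarrow> 'r set" where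
  "gamma_bar R G E \<beta> \<rho> Q = centralizer R (invariant_ring R G E \<beta> (\<rho> Q))"

end

theory Submission
  imports Defs
begin

text \<open>
  The centralizer \<open>V\<close> of the invariants of a wide subgroupoid \<open>H\<close> detects \<open>S\<^sub>H\<close>. On the one hand
  \<open>J\<^sub>g \<subseteq> V\<close> for \<open>g \<in> H\<close>. On the other hand let \<open>r \<in> J\<^sub>g \<inter> V\<close> with \<open>g \<notin> H\<close>, let \<open>x\<^sub>i, y\<^sub>i\<close> be Galois
  coordinates and let \<open>t\<close> be the trace of \<open>H\<close>, which takes invariant values. Then
  \<open>r = \<Sum> x\<^sub>i t(y\<^sub>i) r = \<Sum> x\<^sub>i r t(y\<^sub>i) = r \<Sum> \<beta>\<^sub>g(x\<^sub>i 1) t(y\<^sub>i)\<close>, and the last sum vanishes because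
  \<open>\<Sum> \<beta>\<^sub>g(x\<^sub>i 1) \<beta>\<^sub>h(y\<^sub>i 1) = 0\<close> for all \<open>h \<noteq> g\<close>. This gives the claim for the centralizers; as
  \<open>V(S C(R)) = V(S)\<close>, the other map is injective, too.
\<close>

section \<open>Cancellation and left translation in groupoids\<close>

lemma (in groupoid) prd_ginv_cancel:
  assumes "g \<in> Arr G" "h \<in> Arr G" "tgt G g = tgt G h"
  shows "prd G g (prd G (ginv G g) h) = h"
  using assms prd_assoc[of g "ginv G g" h]
  by (simp add: ginv_closed src_ginv tgt_ginv prd_ginv tgt_prd_id)

lemma (in groupoid) ginv_prd_cancel:
  assumes "g \<in> Arr G" "h \<in> Arr G" "src G g = tgt G h"
  shows "prd G (ginv G g) (prd G g h) = h"
  using assms prd_assoc[of "ginv G g" g h]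
  by (simp add: ginv_closed src_ginv tgt_ginv ginv_prd tgt_prd_id)

text \<open>An arrow equal to its source also equals its target, which for
  \<open>prd G (ginv G g) h\<close> is \<open>src G g\<close>; multiplying by \<open>g\<close> then
  gives \<open>h = g\<close>. Read contrapositively: distinct arrows with a common target produce a
  non-object, where the Galois sums vanish.\<close>

lemma (in groupoid) eq_if_ginv_prd_object:
  assumes "g \<in> Arr G" "h \<in> Arr G" "tgt G g = tgt G h"
    and "src G (prd G (ginv G g) h) = prd G (ginv G g) h"
  shows "g = h"
proof -
  let ?k = "prd G (ginv G g) h"
  have k: "?k \<in> Arr G" "tgt G ?k = src G g"
    using assms by (simp_all add: prd_closed tgt_prd ginv_closed src_ginv tgt_ginv)
  then have "?k = src G g"
    using assms(4) tgt_src[of ?k] by simp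
  then show ?thesis
    using prd_ginv_cancel[OF assms(1-3)] prd_src[OF assms(1)] by simp
qed

lemma (in groupoid) tgt_mem_subgroupoid:
  assumes "wide_subgroupoid G H" "g \<in> Arr G"
  shows "tgt G g \<in> H"
  using assms tgt_closed[of g] src_tgt[of g]
  unfolding wide_subgroupoid_def objects_def by blast

text \<open>The groupoid form of the fact that left translation permutes a group, with translation
  by \<open>ginv G g\<close> as inverse. It serves to reindex the trace of \<open>H\<close>.\<close>

lemma (in groupoid) bij_betw_prd_subgroupoid:
  assumes "subgroupoid G H" "g \<in> H"
  shows "bij_betw (prd G g) {h \<in> H. tgt G h = src G g} {h \<in> H. tgt G h = tgt G g}"
proof (rule bij_betwI[where g = "prd G (ginv G g)"])
  have sub: "h \<in> Arr G" if "h \<in> H" for h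
    using assms that unfolding subgroupoid_def by blast
  have prd: "prd G a b \<in> H" if "a \<in> H" "b \<in> H" "src G a = tgt G b" for a b
    using assms that unfolding subgroupoid_def by blast
  have inv: "ginv G g \<in> H"
    using assms unfolding subgroupoid_def by blast
  show "prd G g \<in> {h \<in> H. tgt G h = src G g} \<rightarrow> {h \<in> H. tgt G h = tgt G g}"
    using assms(2) by (auto simp: prd tgt_prd sub)
  show "prd G (ginv G g) \<in> {h \<in> H. tgt G h = tgt G g} \<rightarrow> {h \<in> H. tgt G h = src G g}"
    using assms(2) by (auto simp: prd inv tgt_prd sub src_ginv tgt_ginv)
qed (use assms in \<open>auto simp: subgroupoid_def prd_ginv_cancel ginv_prd_cancel subset_iff\<close>)

section \<open>Finite sums and centralizers\<close>

lemma (in abelian_monoid) finsum_swap: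
  assumes "finite A" "finite B" "\<And>i j. i \<in> A \<Longrightarrow> j \<in> B \<Longrightarrow> f i j \<in> carrier G"
  shows "(\<Oplus>i\<in>A. \<Oplus>j\<in>B. f i j) = (\<Oplus>j\<in>B. \<Oplus>i\<in>A. f i j)"
  using assms(1,3)
proof (induction A rule: finite_induct)
  case empty
  then show ?case by simp
next
  case (insert a A)
  have "(\<Oplus>j\<in>B. \<Oplus>i\<in>insert a A. f i j) = (\<Oplus>j\<in>B. f a j \<oplus> (\<Oplus>i\<in>A. f i j))"
    using insert by (intro finsum_cong') (auto intro!: finsum_closed finsum_insert)
  also have "\<dots> = (\<Oplus>j\<in>B. f a j) \<oplus> (\<Oplus>j\<in>B. \<Oplus>i\<in>A. f i j)"
    using insert by (intro finsum_addf) (auto intro!: finsum_closed)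
  also have "\<dots> = (\<Oplus>i\<in>insert a A. \<Oplus>j\<in>B. f i j)"
    using insert by (subst finsum_insert) (auto intro!: finsum_closed)
  finally show ?case by simp
qed

lemma (in abelian_group) finsum_hom_apply:
  assumes "finite A" "f \<in> A \<rightarrow> carrier G"
    and "\<And>x. x \<in> carrier G \<Longrightarrow> \<phi> x \<in> carrier G"
    and "\<And>x y. x \<in> carrier G \<Longrightarrow> y \<in> carrier G \<Longrightarrow> \<phi> (x \<oplus> y) = \<phi> x \<oplus> \<phi> y"
  shows "\<phi> (\<Oplus>i\<in>A. f i) = (\<Oplus>i\<in>A. \<phi> (f i))"
  using assms(1,2)
proof (induction A rule: finite_induct)
  case empty
  have "\<phi> \<zero> \<oplus> \<phi> \<zero> = \<phi> \<zero> \<oplus> \<zero>"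
    using assms(3,4)[of \<zero>] assms(4)[of \<zero> \<zero>] by simp
  then have "\<phi> \<zero> = \<zero>"
    using assms(3)[of \<zero>] by (metis add.l_cancel zero_closed)
  then show ?case by simp
next
  case (insert a A)
  then have "f \<in> A \<rightarrow> carrier G" "f a \<in> carrier G" by auto
  moreover from this have "(\<lambda>i. \<phi> (f i)) \<in> A \<rightarrow> carrier G"
    using assms(3) by auto
  ultimately show ?case
    using insert by (simp add: assms(3,4))
qed

text \<open>Whatever commutes with \<open>S\<close> commutes with each
  \<open>s i \<otimes> c i\<close>, as \<open>c i\<close> is central, hence with their sums.
  Conversely \<open>S\<close> lies in \<open>mult_center R S\<close> because \<open>\<one>\<close>
  is central.\<close>

lemma (in ring) centralizer_mult_center:
  assumes "S \<subseteq> carrier R"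
  shows "centralizer R (mult_center R S) = centralizer R S"
proof (intro equalityI subsetI)
  fix r assume r: "r \<in> centralizer R (mult_center R S)"
  have "s \<in> mult_center R S" if "s \<in> S" for s
  proof -
    have "s = (\<Oplus>i\<in>{1..1::nat}. s \<otimes> \<one>)"
      using that assms by auto
    moreover have "\<one> \<in> center R"
      by (simp add: center_def centralizer_def)
    ultimately show ?thesis
      using that unfolding mult_center_def
      by (intro CollectI exI[of _ 1] exI[of _ "\<lambda>_. s"] exI[of _ "\<lambda>_. \<one>"]) auto
  qed
  then show "r \<in> centralizer R S"
    using r by (auto simp: centralizer_def)
next
  fix r assume r: "r \<in> centralizer R S"
  then have [simp]: "r \<in> carrier R" by (simp add: centralizer_def)
  have "r \<otimes> (\<Oplus>i\<in>{1..n}. s i \<otimes> c i) = (\<Oplus>i\<in>{1..n}. s i \<otimes> c i) \<otimes> r"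
    if s: "s \<in> {1..n} \<rightarrow> S" and c: "c \<in> {1..n} \<rightarrow> center R" for n :: nat and s c
  proof -
    have [simp]: "s i \<in> carrier R" "c i \<in> carrier R" if "i \<in> {1..n}" for i
      using s c assms that by (auto simp: center_def centralizer_def)
    have comm: "r \<otimes> (s i \<otimes> c i) = (s i \<otimes> c i) \<otimes> r" if "i \<in> {1..n}" for i
    proof -
      have "s i \<in> S" "c i \<in> center R"
        using s c that by blast+
      then have "r \<otimes> s i = s i \<otimes> r" "r \<otimes> c i = c i \<otimes> r"
        using r by (auto simp: center_def centralizer_def)
      then show ?thesis
        using that by (metis \<open>r \<in> carrier R\<close> \<open>\<And>i. i \<in> {1..n} \<Longrightarrow> s i \<in> carrier R\<close>
            \<open>\<And>i. i \<in> {1..n} \<Longrightarrow> c i \<in> carrier R\<close> m_assoc)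
    qed
    have "r \<otimes> (\<Oplus>i\<in>{1..n}. s i \<otimes> c i) = (\<Oplus>i\<in>{1..n}. r \<otimes> (s i \<otimes> c i))"
      by (rule finsum_rdistr) auto
    also have "\<dots> = (\<Oplus>i\<in>{1..n}. (s i \<otimes> c i) \<otimes> r)"
      by (rule finsum_cong') (auto simp: comm)
    also have "\<dots> = (\<Oplus>i\<in>{1..n}. s i \<otimes> c i) \<otimes> r"
      by (rule finsum_ldistr[symmetric]) auto
    finally show ?thesis .
  qed
  then show "r \<in> centralizer R (mult_center R S)"
    by (auto simp: centralizer_def mult_center_def)
qed

section \<open>Identity elements of the ideals and the globally defined maps
  \<open>act\<close>\<close>

context unital_groupoid_action
begin

abbreviation
  "unit_of g \<equiv> identity_of R (E g)"

text \<open>Projecting onto the domain ideal first extends \<open>\<beta> g\<close> to all of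
  \<open>carrier R\<close>. Invariants, the Galois condition and \<open>J_set\<close> all use
  \<open>\<beta>\<close> in exactly this form.\<close>

definition
  "act g x = \<beta> g (x \<otimes> unit_of (ginv G g))"

lemma is_identity_of_unit_of:
  assumes "g \<in> Arr G"
  shows "is_identity_of R (E g) (unit_of g)"
proof -
  obtain u where u: "is_identity_of R (E g) u"
    using E_unital[OF assms] by blast
  have "v = u" if "is_identity_of R (E g) v" for v
    using u that by (metis is_identity_of_def)
  then show ?thesis
    unfolding identity_of_def using u by (rule theI[rotated])
qed

lemma unit_of_mem: "g \<in> Arr G \<Longrightarrow> unit_of g \<in> E g"
  and unit_of_mult: "g \<in> Arr G \<Longrightarrow> x \<in> E g \<Longrightarrow> unit_of g \<otimes> x = x"
  and mult_unit_of: "g \<in> Arr G \<Longrightarrow> x \<in> E g \<Longrightarrow> x \<otimes> unit_of g = x"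
  using is_identity_of_unit_of by (simp_all add: is_identity_of_def)

lemma E_closed: "g \<in> Arr G \<Longrightarrow> x \<in> E g \<Longrightarrow> x \<in> carrier R"
  using E_ideal ideal.Icarr by metis

lemma unit_of_closed [simp]: "g \<in> Arr G \<Longrightarrow> unit_of g \<in> carrier R"
  using E_closed unit_of_mem by blast

lemma E_mult_left: "g \<in> Arr G \<Longrightarrow> x \<in> carrier R \<Longrightarrow> a \<in> E g \<Longrightarrow> x \<otimes> a \<in> E g"
  and E_mult_right: "g \<in> Arr G \<Longrightarrow> x \<in> carrier R \<Longrightarrow> a \<in> E g \<Longrightarrow> a \<otimes> x \<in> E g"
  and zero_mem_E: "g \<in> Arr G \<Longrightarrow> \<zero> \<in> E g"
  using E_ideal[of g] ideal.I_l_closed ideal.I_r_closed additive_subgroup.zero_closed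
    ideal.axioms(1) by metis+

text \<open>Both products lie in the ideal \<open>E g\<close>, so both equal
  \<open>unit_of g \<otimes> x \<otimes> unit_of g\<close>.\<close>

lemma unit_of_central:
  assumes "g \<in> Arr G" "x \<in> carrier R"
  shows "unit_of g \<otimes> x = x \<otimes> unit_of g"
proof -
  have "unit_of g \<otimes> x = (unit_of g \<otimes> x) \<otimes> unit_of g"
    using assms by (simp add: mult_unit_of E_mult_right unit_of_mem)
  also have "\<dots> = x \<otimes> unit_of g"
    using assms by (simp add: m_assoc unit_of_mult E_mult_left unit_of_mem)
  finally show ?thesis .
qed

lemma mult_unit_of_mem: "g \<in> Arr G \<Longrightarrow> x \<in> carrier R \<Longrightarrow> x \<otimes> unit_of g \<in> E g"
  by (simp add: E_mult_left unit_of_mem)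

lemma act_mem: "g \<in> Arr G \<Longrightarrow> x \<in> carrier R \<Longrightarrow> act g x \<in> E g"
  unfolding act_def using beta_bij[of g] mult_unit_of_mem[of "ginv G g" x]
  by (auto simp: bij_betw_def ginv_closed)

lemma act_closed [simp]: "g \<in> Arr G \<Longrightarrow> x \<in> carrier R \<Longrightarrow> act g x \<in> carrier R"
  using act_mem E_closed by blast

lemma act_add:
  assumes "g \<in> Arr G" "x \<in> carrier R" "y \<in> carrier R"
  shows "act g (x \<oplus> y) = act g x \<oplus> act g y"
  using assms unfolding act_def
  by (simp add: l_distr ginv_closed beta_add mult_unit_of_mem)

text \<open>The projection onto the domain ideal is multiplicative: \<open>y \<otimes> ?u\<close>
  already lies in the ideal, so the inner factor \<open>?u\<close> is absorbed.\<close>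

lemma act_mult:
  assumes "g \<in> Arr G" "x \<in> carrier R" "y \<in> carrier R"
  shows "act g (x \<otimes> y) = act g x \<otimes> act g y"
proof -
  let ?u = "unit_of (ginv G g)"
  have i: "ginv G g \<in> Arr G" using assms ginv_closed by blast
  have "(x \<otimes> ?u) \<otimes> (y \<otimes> ?u) = x \<otimes> (?u \<otimes> (y \<otimes> ?u))"
    using assms i by (simp add: m_assoc)
  also have "?u \<otimes> (y \<otimes> ?u) = y \<otimes> ?u"
    using assms i by (simp add: unit_of_mult mult_unit_of_mem)
  also have "x \<otimes> (y \<otimes> ?u) = (x \<otimes> y) \<otimes> ?u"
    using assms i by (simp add: m_assoc)
  finally show ?thesis
    using assms i unfolding act_def by (simp flip: beta_mult add: mult_unit_of_mem)
qed

lemma act_finsum: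
  assumes "g \<in> Arr G" "finite A" "f \<in> A \<rightarrow> carrier R"
  shows "act g (\<Oplus>i\<in>A. f i) = (\<Oplus>i\<in>A. act g (f i))"
  using assms by (intro finsum_hom_apply) (auto simp: act_add)

lemma act_zero: "g \<in> Arr G \<Longrightarrow> act g \<zero> = \<zero>"
  using act_finsum[of g "{}" "\<lambda>_. \<zero>"] by simp

lemma E_ginv: "g \<in> Arr G \<Longrightarrow> E (ginv G g) = E (src G g)"
  using E_tgt[of "ginv G g"] by (simp add: ginv_closed tgt_ginv)

text \<open>The arrows \<open>h\<close> and \<open>prd G g h\<close> have the same source, hence the
  same domain ideal, and \<open>act h x\<close> lies in \<open>E h\<close>, the domain of
  \<open>\<beta> g\<close>, so the outer projection changes nothing.\<close>

lemma act_act: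
  assumes "g \<in> Arr G" "h \<in> Arr G" "src G g = tgt G h" "x \<in> carrier R"
  shows "act g (act h x) = act (prd G g h) x"
proof -
  have gh: "prd G g h \<in> Arr G" using assms prd_closed by blast
  have E: "E (ginv G (prd G g h)) = E (ginv G h)" "E (ginv G g) = E h"
    using assms gh by (simp_all add: E_ginv src_prd E_tgt[symmetric])
  have "act h x \<in> E h" using assms act_mem by blast
  then have "act g (act h x) = \<beta> g (act h x)"
    using assms E(2) mult_unit_of[of h] by (simp add: act_def[of g])
  also have "\<dots> = \<beta> (prd G g h) (x \<otimes> unit_of (ginv G h))"
    using assms by (simp add: act_def beta_comp mult_unit_of_mem ginv_closed)
  finally show ?thesis by (simp add: act_def E(1))
qed

section \<open>Invariants and the sets \<open>J_set\<close>\<close>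

lemma invariant_ring_iff:
  "r \<in> invariant_ring R G E \<beta> H \<longleftrightarrow> r \<in> carrier R \<and> (\<forall>h\<in>H. act h r = r \<otimes> unit_of h)"
  by (simp add: invariant_ring_def act_def)

lemma J_set_iff:
  "r \<in> J_set R G E \<beta> g \<longleftrightarrow> r \<in> E g \<and> (\<forall>x\<in>carrier R. r \<otimes> act g x = x \<otimes> r)"
  by (simp add: J_set_def act_def)

lemma zero_mem_J_set: "g \<in> Arr G \<Longrightarrow> \<zero> \<in> J_set R G E \<beta> g"
  by (simp add: J_set_iff zero_mem_E)

text \<open>For an invariant \<open>s\<close> the defining relation of \<open>J_set\<close> reads
  \<open>r \<otimes> (s \<otimes> unit_of g) = s \<otimes> r\<close>, and \<open>r\<close>, lying in
  \<open>E g\<close>, absorbs the central \<open>unit_of g\<close>.\<close>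

lemma J_set_subset_centralizer:
  assumes "g \<in> Arr G" "g \<in> H"
  shows "J_set R G E \<beta> g \<subseteq> centralizer R (invariant_ring R G E \<beta> H)"
proof
  fix r assume r: "r \<in> J_set R G E \<beta> g"
  then have rE: "r \<in> E g" and rR: "r \<in> carrier R"
    using assms E_closed by (auto simp: J_set_iff)
  have "r \<otimes> s = s \<otimes> r" if "s \<in> invariant_ring R G E \<beta> H" for s
  proof -
    from that assms have s: "s \<in> carrier R" "act g s = s \<otimes> unit_of g"
      by (auto simp: invariant_ring_iff)
    have "r \<otimes> act g s = s \<otimes> r"
      using r s(1) unfolding J_set_iff by blast
    also have "r \<otimes> act g s = (r \<otimes> unit_of g) \<otimes> s"
      using assms(1) rR s unit_of_central[of g s] by (simp add: m_assoc)
    also have "\<dots> = r \<otimes> s"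
      using assms rE by (simp add: mult_unit_of)
    finally show ?thesis .
  qed
  then show "r \<in> centralizer R (invariant_ring R G E \<beta> H)"
    using rR by (simp add: centralizer_def)
qed

section \<open>Orthogonality of the ideals\<close>

text \<open>A common element of two summands has two decompositions, one concentrated at
  \<open>e\<close> and one at \<open>f\<close>; by uniqueness they agree, and comparing them at
  \<open>e\<close> gives zero.\<close>

lemma E_inter_eq_zero:
  assumes fin: "finite (Arr G)" and dir: "is_direct_sum R (objects G (Arr G)) E"
    and ef: "e \<in> objects G (Arr G)" "f \<in> objects G (Arr G)" "e \<noteq> f"
    and x: "x \<in> E e" "x \<in> E f"
  shows "x = \<zero>"
proof -
  let ?O = "objects G (Arr G)"
  \<comment> \<open>The family is restricted to \<open>?O\<close> because
    \<open>is_direct_sum\<close> asserts uniqueness only among extensional families.\<close>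
  let ?p = "\<lambda>a. \<lambda>c\<in>?O. if a = c then x else \<zero>"
  have O: "finite ?O" "\<And>c. c \<in> ?O \<Longrightarrow> c \<in> Arr G"
    using fin by (auto simp: objects_def)
  have xR: "x \<in> carrier R" using x ef O E_closed by blast
  have p: "?p a \<in> (\<Pi>\<^sub>E c\<in>?O. E c) \<and> x = (\<Oplus>c\<in>?O. ?p a c)"
    if a: "a \<in> ?O" "x \<in> E a" for a
  proof
    show "?p a \<in> (\<Pi>\<^sub>E c\<in>?O. E c)"
      using a O zero_mem_E by auto
    have "(\<Oplus>c\<in>?O. ?p a c) = (\<Oplus>c\<in>?O. if a = c then x else \<zero>)"
      using xR by (intro finsum_cong') auto
    then show "x = (\<Oplus>c\<in>?O. ?p a c)"
      using add.finprod_singleton[of a ?O "\<lambda>_. x"] a O(1) xR by simp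
  qed
  have "?p e = ?p f"
    using dir xR p[of e] p[of f] ef x unfolding is_direct_sum_def by blast
  then have "?p e e = ?p f e" by (rule fun_cong)
  then show ?thesis using ef by simp
qed

text \<open>The product lies in both ideals, and these are the summands attached to the two distinct
  targets.\<close>

lemma E_mult_eq_zero:
  assumes fin: "finite (Arr G)" and dir: "is_direct_sum R (objects G (Arr G)) E"
    and gh: "g \<in> Arr G" "h \<in> Arr G" "tgt G g \<noteq> tgt G h"
    and xy: "x \<in> E g" "y \<in> E h"
  shows "x \<otimes> y = \<zero>"
proof (rule E_inter_eq_zero[OF fin dir])
  show "tgt G g \<in> objects G (Arr G)" "tgt G h \<in> objects G (Arr G)"
    using gh by (auto simp: objects_def tgt_closed src_tgt)
  show "x \<otimes> y \<in> E (tgt G g)" "x \<otimes> y \<in> E (tgt G h)"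
    using gh xy E_mult_left E_mult_right E_closed E_tgt by auto
qed (fact gh)

section \<open>The trace of a subgroupoid\<close>

definition
  "trace H x = (\<Oplus>h\<in>H. act h x)"

text \<open>Applying \<open>act g\<close> kills the summands not composable with \<open>g\<close>
  and moves the others, by left translation, onto the arrows of \<open>H\<close> with target
  \<open>tgt G g\<close>. Multiplication by \<open>unit_of g\<close> selects the same
  summands.\<close>

lemma trace_mem_invariant_ring:
  assumes fin: "finite (Arr G)" and dir: "is_direct_sum R (objects G (Arr G)) E"
    and H: "subgroupoid G H" and x: "x \<in> carrier R"
  shows "trace H x \<in> invariant_ring R G E \<beta> H"
  unfolding invariant_ring_iff
proof (intro conjI ballI)
  have sub: "H \<subseteq> Arr G" using H by (simp add: subgroupoid_def)
  then have finH: "finite H" using fin finite_subset by blast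
  have cl: "act h x \<in> carrier R" if "h \<in> H" for h
    using that sub x by auto
  then show "trace H x \<in> carrier R"
    unfolding trace_def by (intro finsum_closed) auto
  fix g assume g: "g \<in> H"
  then have gA: "g \<in> Arr G" using sub by blast
  let ?A = "{h \<in> H. tgt G h = src G g}" and ?B = "{h \<in> H. tgt G h = tgt G g}"
  have act_eq_zero: "act g (act h x) = \<zero>" if "h \<in> H - ?A" for h
  proof -
    have "act h x \<otimes> unit_of (ginv G g) = \<zero>"
      using that gA sub x
      by (intro E_mult_eq_zero[OF fin dir, of h "ginv G g"])
        (auto simp: ginv_closed tgt_ginv act_mem unit_of_mem)
    then show ?thesis
      using gA act_zero[of g] by (simp add: act_def[of g] ginv_closed)
  qed
  have "act g (trace H x) = (\<Oplus>h\<in>H. act g (act h x))"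
    unfolding trace_def using gA finH cl by (intro act_finsum) auto
  also have "\<dots> = (\<Oplus>h\<in>?A. act g (act h x))"
    using finH act_eq_zero gA cl
    by (intro add.finprod_mono_neutral_cong_right) auto
  also have "\<dots> = (\<Oplus>h\<in>?A. act (prd G g h) x)"
    using sub gA x by (intro finsum_cong') (auto simp: act_act prd_closed)
  also have "\<dots> = (\<Oplus>h\<in>prd G g ` ?A. act h x)"
    using bij_betw_prd_subgroupoid[OF H g] sub gA x
    by (subst finsum_reindex) (auto simp: bij_betw_def prd_closed)
  also have "prd G g ` ?A = ?B"
    using bij_betw_prd_subgroupoid[OF H g] by (simp add: bij_betw_def)
  \<comment> \<open>On \<open>?B\<close> the ideals \<open>E h\<close> and \<open>E g\<close>
    coincide, so \<open>unit_of g\<close> may be inserted; outside \<open>?B\<close> it annihilates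
    the summands, so the sum then extends to all of \<open>H\<close>.\<close>
  also have "(\<Oplus>h\<in>?B. act h x) = (\<Oplus>h\<in>?B. act h x \<otimes> unit_of g)"
  proof (rule finsum_cong')
    show "act h x = act h x \<otimes> unit_of g" if "h \<in> ?B" for h
    proof -
      have "E h = E g" using that sub gA E_tgt[of h] E_tgt[of g] by auto
      then show ?thesis
        using that sub gA x act_mem[of h x] by (auto simp: mult_unit_of)
    qed
  qed (use cl gA in auto)
  also have "\<dots> = (\<Oplus>h\<in>H. act h x \<otimes> unit_of g)"
  proof (rule add.finprod_mono_neutral_cong_left[OF finH])
    show "act h x \<otimes> unit_of g = \<zero>" if "h \<in> H - ?B" for h
      using that sub gA x
      by (intro E_mult_eq_zero[OF fin dir, of h g]) (auto simp: act_mem unit_of_mem)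
  qed (use cl gA in auto)
  also have "\<dots> = trace H x \<otimes> unit_of g"
    unfolding trace_def using gA finH cl by (intro finsum_ldistr[symmetric]) auto
  finally show "act g (trace H x) = trace H x \<otimes> unit_of g" .
qed

section \<open>Galois coordinates\<close>

definition
  "galois_coordinates I x y \<longleftrightarrow> finite I \<and> x \<in> I \<rightarrow> carrier R \<and> y \<in> I \<rightarrow> carrier R \<and>
     (\<forall>g\<in>Arr G. (\<Oplus>i\<in>I. x i \<otimes> act g (y i)) =
        (if g \<in> objects G (Arr G) then unit_of g else \<zero>))"

lemma galois_extension_imp_coordinates:
  assumes "finite (Arr G)" "galois_extension R G E \<beta>"
  obtains m :: nat and x y where "galois_coordinates {1..m} x y"
proof -
  obtain m :: nat and x y where xy: "x \<in> {1..m} \<rightarrow> carrier R" "y \<in> {1..m} \<rightarrow> carrier R"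
    and gal: "\<And>g. g \<in> Arr G \<Longrightarrow> (\<Oplus>i\<in>{1..m}. x i \<otimes> act g (y i)) =
      (\<Oplus>e\<in>objects G (Arr G). if e = g then unit_of e else \<zero>)"
    using assms(2) unfolding galois_extension_def act_def by blast
  have O: "finite (objects G (Arr G))" "objects G (Arr G) \<subseteq> Arr G"
    using assms(1) by (auto simp: objects_def)
  have "(\<Oplus>e\<in>objects G (Arr G). if e = g then unit_of e else \<zero>) =
      (if g \<in> objects G (Arr G) then unit_of g else \<zero>)" for g
  proof (cases "g \<in> objects G (Arr G)")
    case True
    then show ?thesis
      using add.finprod_singleton_swap[of g "objects G (Arr G)" unit_of] O by (auto simp: Pi_iff subset_iff)
  next
    case False
    have "(\<Oplus>e\<in>objects G (Arr G). if e = g then unit_of e else \<zero>) =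
        (\<Oplus>e\<in>objects G (Arr G). \<zero>)"
      using False by (intro finsum_cong') auto
    then show ?thesis using False by simp
  qed
  then show ?thesis
    using that[of m x y] xy gal by (simp add: galois_coordinates_def)
qed

text \<open>For equal targets write \<open>h\<close> as \<open>g\<close> times \<open>?k\<close>:
  the sum is \<open>act g\<close> applied to the Galois sum at \<open>?k\<close>, which is zero
  since \<open>?k\<close> is not an object. For different targets every summand vanishes by
  orthogonality.\<close>

lemma galois_coordinates_act:
  assumes fin: "finite (Arr G)" and dir: "is_direct_sum R (objects G (Arr G)) E"
    and gal: "galois_coordinates I x y"
    and gh: "g \<in> Arr G" "h \<in> Arr G" "g \<noteq> h"
  shows "(\<Oplus>i\<in>I. act g (x i) \<otimes> act h (y i)) = \<zero>"
proof (cases "tgt G g = tgt G h")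
  case False
  have "(\<Oplus>i\<in>I. act g (x i) \<otimes> act h (y i)) = (\<Oplus>i\<in>I. \<zero>)"
    using gal gh False
    by (intro finsum_cong' E_mult_eq_zero[OF fin dir, of g h])
      (auto simp: galois_coordinates_def Pi_iff act_mem)
  then show ?thesis by simp
next
  case True
  let ?k = "prd G (ginv G g) h"
  have k: "?k \<in> Arr G" "src G g = tgt G ?k" "prd G g ?k = h"
    using gh True by (auto simp: prd_closed tgt_prd ginv_closed src_ginv tgt_ginv prd_ginv_cancel)
  have xR: "x i \<in> carrier R" and yR: "y i \<in> carrier R" if "i \<in> I" for i
    using gal that by (auto simp: galois_coordinates_def)
  have "(\<Oplus>i\<in>I. act g (x i) \<otimes> act h (y i)) = (\<Oplus>i\<in>I. act g (x i \<otimes> act ?k (y i)))"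
    using gh k by (intro finsum_cong') (auto simp: act_mult act_act xR yR)
  also have "\<dots> = act g (\<Oplus>i\<in>I. x i \<otimes> act ?k (y i))"
    using gal gh k
    by (intro act_finsum[symmetric]) (auto simp: xR yR galois_coordinates_def)
  also have "(\<Oplus>i\<in>I. x i \<otimes> act ?k (y i)) = \<zero>"
    using gal k eq_if_ginv_prd_object[OF gh(1,2) True] gh(3)
    by (auto simp: galois_coordinates_def objects_def)
  finally show ?thesis using gh by (simp add: act_zero)
qed

section \<open>Detecting arrows by the centralizer of the invariants\<close>

lemma J_set_inter_centralizer_eq_zero:
  assumes fin: "finite (Arr G)" and dir: "is_direct_sum R (objects G (Arr G)) E"
    and gal: "galois_coordinates I x y" and H: "wide_subgroupoid G H"
    and g: "g \<in> Arr G" "g \<notin> H"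
    and r: "r \<in> J_set R G E \<beta> g" "r \<in> centralizer R (invariant_ring R G E \<beta> H)"
  shows "r = \<zero>"
proof -
  have subgr: "subgroupoid G H" using H by (simp add: wide_subgroupoid_def)
  then have sub: "H \<subseteq> Arr G" by (simp add: subgroupoid_def)
  then have finH: "finite H" using fin finite_subset by blast
  have finI: "finite I" using gal by (simp add: galois_coordinates_def)
  have xR: "x i \<in> carrier R" and yR: "y i \<in> carrier R" if "i \<in> I" for i
    using gal that by (auto simp: galois_coordinates_def)
  have rE: "r \<in> E g" and rR [simp]: "r \<in> carrier R"
    using r g E_closed by (auto simp: J_set_iff)
  have inv: "trace H (y i) \<in> invariant_ring R G E \<beta> H" if "i \<in> I" for i
    using trace_mem_invariant_ring[OF fin dir subgr yR[OF that]] .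
  then have tR: "trace H (y i) \<in> carrier R" if "i \<in> I" for i
    using that by (auto simp: invariant_ring_iff)
  \<comment> \<open>Needed twice: for \<open>a = x\<close>, and for
    \<open>a i = act g (x i)\<close>.\<close>
  have sum_trace: "(\<Oplus>i\<in>I. a i \<otimes> trace H (y i)) = (\<Oplus>h\<in>H. \<Oplus>i\<in>I. a i \<otimes> act h (y i))"
    if a: "\<And>i. i \<in> I \<Longrightarrow> a i \<in> carrier R" for a
  proof -
    have "(\<Oplus>i\<in>I. a i \<otimes> trace H (y i)) = (\<Oplus>i\<in>I. \<Oplus>h\<in>H. a i \<otimes> act h (y i))"
      unfolding trace_def using finH sub a yR
      by (intro finsum_cong') (auto intro!: finsum_rdistr finsum_closed)
    also have "\<dots> = (\<Oplus>h\<in>H. \<Oplus>i\<in>I. a i \<otimes> act h (y i))"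
      using finI finH sub a yR by (intro finsum_swap) auto
    finally show ?thesis .
  qed
  \<comment> \<open>The Galois sum is \<open>unit_of h\<close> at objects and zero elsewhere; among
    the objects only \<open>tgt G g\<close> has an identity not annihilating
    \<open>E g\<close>.\<close>
  have unit_mult: "(\<Oplus>i\<in>I. x i \<otimes> act h (y i)) \<otimes> r = (if tgt G g = h then r else \<zero>)"
    if h: "h \<in> H" for h
  proof (cases "h \<in> objects G (Arr G)")
    case True
    then have hA: "h \<in> Arr G" "tgt G h = h"
      using tgt_src[of h] by (auto simp: objects_def)
    have "unit_of h \<otimes> r = (if tgt G g = h then r else \<zero>)"
    proof (cases "tgt G g = h")
      case True
      then have "E h = E g" using E_tgt[OF g(1)] by simp
      then show ?thesis using True rE unit_of_mult[OF g(1)] by simp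
    next
      case False
      then show ?thesis
        using E_mult_eq_zero[OF fin dir hA(1) g(1) _ unit_of_mem[OF hA(1)] rE] hA(2) by auto
    qed
    then show ?thesis using gal hA True by (simp add: galois_coordinates_def)
  next
    case False
    then have "tgt G g \<noteq> h"
      using g by (auto simp: objects_def tgt_closed src_tgt)
    then show ?thesis
      using gal h sub False by (auto simp: galois_coordinates_def)
  qed
  \<comment> \<open>Wideness enters here: \<open>tgt G g\<close> belongs to \<open>H\<close>, so the
    summand \<open>r\<close> occurs exactly once.\<close>
  have "r = (\<Oplus>h\<in>H. if tgt G g = h then r else \<zero>)"
    using add.finprod_singleton[of "tgt G g" H "\<lambda>_. r"] finH tgt_mem_subgroupoid[OF H g(1)] by simp
  also have "\<dots> = (\<Oplus>h\<in>H. (\<Oplus>i\<in>I. x i \<otimes> act h (y i)) \<otimes> r)"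
    using sub xR yR by (intro finsum_cong') (auto simp: unit_mult)
  also have "\<dots> = (\<Oplus>h\<in>H. \<Oplus>i\<in>I. x i \<otimes> act h (y i)) \<otimes> r"
    using finH sub xR yR by (intro finsum_ldistr[symmetric]) (auto intro!: finsum_closed)
  also have "(\<Oplus>h\<in>H. \<Oplus>i\<in>I. x i \<otimes> act h (y i)) = (\<Oplus>i\<in>I. x i \<otimes> trace H (y i))"
    by (rule sum_trace[symmetric]) (fact xR)
  also have "(\<Oplus>i\<in>I. x i \<otimes> trace H (y i)) \<otimes> r = (\<Oplus>i\<in>I. x i \<otimes> trace H (y i) \<otimes> r)"
    using finI xR tR by (intro finsum_ldistr) auto
  also have "\<dots> = (\<Oplus>i\<in>I. r \<otimes> (act g (x i) \<otimes> trace H (y i)))"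
  proof (rule finsum_cong')
    show "x i \<otimes> trace H (y i) \<otimes> r = r \<otimes> (act g (x i) \<otimes> trace H (y i))" if i: "i \<in> I" for i
    proof -
      \<comment> \<open>First \<open>r\<close> passes the invariant trace, being in the centralizer;
        then the relation of \<open>J_set\<close> moves it past \<open>x i\<close>, which becomes
        \<open>act g (x i)\<close>.\<close>
      have "x i \<otimes> trace H (y i) \<otimes> r = x i \<otimes> (r \<otimes> trace H (y i))"
        using r(2) inv[OF i] xR[OF i] tR[OF i] by (simp add: m_assoc centralizer_def)
      also have "\<dots> = (r \<otimes> act g (x i)) \<otimes> trace H (y i)"
        using r(1) xR[OF i] tR[OF i] by (simp add: m_assoc J_set_iff)
      finally show ?thesis
        using g xR[OF i] tR[OF i] by (simp add: m_assoc)
    qed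
  qed (use g xR tR in auto)
  also have "\<dots> = r \<otimes> (\<Oplus>i\<in>I. act g (x i) \<otimes> trace H (y i))"
    using finI g xR tR by (intro finsum_rdistr[symmetric]) auto
  also have "(\<Oplus>i\<in>I. act g (x i) \<otimes> trace H (y i)) =
      (\<Oplus>h\<in>H. \<Oplus>i\<in>I. act g (x i) \<otimes> act h (y i))"
    by (rule sum_trace) (simp add: g(1) xR)
  \<comment> \<open>As \<open>g\<close> is outside \<open>H\<close>, every index \<open>h\<close>
    differs from \<open>g\<close>.\<close>
  also have "\<dots> = (\<Oplus>h\<in>H. \<zero>)"
    using g(2) sub by (intro finsum_cong' galois_coordinates_act[OF fin dir gal g(1)]) auto
  finally show ?thesis by simp
qed

text \<open>A nonzero element of \<open>J_set\<close> at \<open>g\<close> in \<open>H\<close> lies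
  in the centralizer for \<open>H\<close>, hence in that for \<open>L\<close>, which is impossible
  if \<open>g\<close> is outside \<open>L\<close>.\<close>

lemma S_set_subset:
  assumes fin: "finite (Arr G)" and dir: "is_direct_sum R (objects G (Arr G)) E"
    and gal: "galois_extension R G E \<beta>"
    and H: "wide_subgroupoid G H" and L: "wide_subgroupoid G L"
    and V: "centralizer R (invariant_ring R G E \<beta> H) \<subseteq> centralizer R (invariant_ring R G E \<beta> L)"
  shows "S_set R G E \<beta> H \<subseteq> S_set R G E \<beta> L"
proof
  fix g assume g: "g \<in> S_set R G E \<beta> H"
  then have gH: "g \<in> H" and gA: "g \<in> Arr G" and J: "J_set R G E \<beta> g \<noteq> {\<zero>}"
    using H by (auto simp: S_set_def wide_subgroupoid_def subgroupoid_def)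
  \<comment> \<open>Since \<open>\<zero>\<close> is always in \<open>J_set\<close>, differing from
    \<open>{\<zero>}\<close> means having a nonzero element.\<close>
  obtain r where r: "r \<in> J_set R G E \<beta> g" "r \<noteq> \<zero>"
    using J zero_mem_J_set[OF gA] by blast
  have "r \<in> centralizer R (invariant_ring R G E \<beta> L)"
    using J_set_subset_centralizer[OF gA gH] r V by blast
  moreover obtain m :: nat and x y where "galois_coordinates {1..m} x y"
    using galois_extension_imp_coordinates[OF fin gal] .
  ultimately have "g \<in> L"
    using J_set_inter_centralizer_eq_zero[OF fin dir _ L gA] r by blast
  then show "g \<in> S_set R G E \<beta> L"
    using J by (simp add: S_set_def)
qed

end

section \<open>Injectivity on classes of subgroupoids\<close>

theorem theorem3p8:
  fixes G :: "('g, 'm) groupoid_struct_scheme"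
    and K :: "('k, 'n) ring_scheme"
    and R :: "('k, 'r, 'p) module_scheme"
    and E :: "'g \<Rightarrow> 'r set"
    and \<beta> :: "'g \<Rightarrow> 'r \<Rightarrow> 'r"
  assumes "unital_groupoid_action G K R E \<beta>"
    and "finite (Arr G)"
    and "is_direct_sum R (objects G (Arr G)) E"
    and "galois_extension R G E \<beta>"
    and "separable_over (R\<lparr>carrier := invariant_ring R G E \<beta> (Arr G)\<rparr>)
           (center R \<inter> invariant_ring R G E \<beta> (Arr G))"
  shows "\<forall>\<rho>. wide_representatives R G E \<beta> \<rho> \<longrightarrow>
           inj_on (sigma_bar R G E \<beta> \<rho>) (wide_classes R G E \<beta>) \<and>
           inj_on (gamma_bar R G E \<beta> \<rho>) (wide_classes R G E \<beta>)"
proof (intro allI impI)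
  interpret unital_groupoid_action G K R E \<beta> by fact
  fix \<rho> assume "wide_representatives R G E \<beta> \<rho>"
  then have \<rho>: "wide_subgroupoid G (\<rho> Q)" "S_class R G E \<beta> (\<rho> Q) = Q"
    if "Q \<in> wide_classes R G E \<beta>" for Q
    using that by (auto simp: wide_representatives_def)
  have gamma: "inj_on (gamma_bar R G E \<beta> \<rho>) (wide_classes R G E \<beta>)"
  proof (rule inj_onI)
    fix P Q
    assume PQ: "P \<in> wide_classes R G E \<beta>" "Q \<in> wide_classes R G E \<beta>"
      and eq: "gamma_bar R G E \<beta> \<rho> P = gamma_bar R G E \<beta> \<rho> Q"
    \<comment> \<open>Equal centralizers give both inclusions, and a class depends on its
      representative only through \<open>S_set\<close>.\<close>
    have "S_set R G E \<beta> (\<rho> P) = S_set R G E \<beta> (\<rho> Q)"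
      using eq S_set_subset[OF assms(2-4)] \<rho>(1)[OF PQ(1)] \<rho>(1)[OF PQ(2)]
      unfolding gamma_bar_def by blast
    then have "S_class R G E \<beta> (\<rho> P) = S_class R G E \<beta> (\<rho> Q)"
      by (simp add: S_class_def)
    then show "P = Q" using \<rho>(2) PQ by simp
  qed
  \<comment> \<open>Taking centralizers factors \<open>gamma_bar\<close> through
    \<open>sigma_bar\<close>, so injectivity passes from the former to the latter.\<close>
  have "gamma_bar R G E \<beta> \<rho> Q = centralizer R (sigma_bar R G E \<beta> \<rho> Q)" for Q
    by (simp add: gamma_bar_def sigma_bar_def centralizer_mult_center invariant_ring_def)
  then have "inj_on (sigma_bar R G E \<beta> \<rho>) (wide_classes R G E \<beta>)"
    using gamma by (auto simp: inj_on_def)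
  then show "inj_on (sigma_bar R G E \<beta> \<rho>) (wide_classes R G E \<beta>) \<and>
      inj_on (gamma_bar R G E \<beta> \<rho>) (wide_classes R G E \<beta>)"
    using gamma by blast
qed

end
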